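(* Let $\mu$ be uniform on $[-1,1]$ and $\nu$ uniform on $[-2,2]$. Define $$D_{\mathrm{lc}}(x)=-\frac x2-\frac32,\qquad U_{\mathrm{lc}}(x)=\frac{3x}2+\frac12,\qquad q_{\mathrm{lc}}(x)=\frac34 .$$ The kernel $K_{\mathrm{lc}}(x,\mathrm dy)=(1-q_{\mathrm{lc}})\delta_{D_{\mathrm{lc}}(x)}(\mathrm dy)+q_{\mathrm{lc}}\delta_{U_{\mathrm{lc}}(x)}(\mathrm dy)$ defines the left-curtain coupling $\mu(\mathrm dx)K_{\mathrm{lc}}(x,\mathrm dy)$ of $\mu$ and $\nu$. For $k>0$, this coupling belongs to $\mathcal M_k(\mu,\nu)$ if and only if $k\ge3$. For every $k\ge 3$ and every $h\in C^1([-3,3])$ with $h'$ convex, it attains $\inf_{\pi\in\mathcal M_k(\mu,\nu)}\int h(y-x)\,\pi(\mathrm dx,\mathrm dy)$.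
   Context: For $k>0$ let $\Gamma_k=\{(x,y)\in\mathbb R^2: y\ge x-k\}$. $\mathcal M_k(\mu,\nu)$ is the set of Borel probability measures $\pi$ on $\mathbb R^2$ with first marginal $\mu$, second marginal $\nu$, $\pi(\Gamma_k)=1$, and, for a disintegration $\pi(\mathrm dx,\mathrm dy)=\mu(\mathrm dx)\pi_x(\mathrm dy)$, $\int y\,\pi_x(\mathrm dy)=x$ for $\mu$-a.e. $x$. A martingale coupling $\pi$ of $\mu,\nu$ (marginals $\mu,\nu$ and $\int y\,\pi_x(\mathrm dy)=x$ for $\mu$-a.e. $x$) is left-monotone if there is a Borel set $S$ with $\pi(S)=1$ containing no three points $(x,y^-),(x,y^+),(x',y')$ with $x<x'$ and $y^-<y'<y^+$. The left-curtain coupling of $\mu,\nu$ is the unique left-monotone martingale coupling of $\mu$ and $\nu$ (existence and uniqueness are due to Beiglböck–Juillet for marginals in convex order). *)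

theory Defs
  imports "HOL-Probability.Probability"
begin

text \<open>The measure \<open>\<mu>(dx) K(x, dy)\<close> on the plane.\<close>

definition kernel_coupling :: "real measure \<Rightarrow> (real \<Rightarrow> real measure) \<Rightarrow> (real \<times> real) measure" where
  "kernel_coupling \<mu> K = \<mu> \<bind> (\<lambda>x. distr (K x) borel (Pair x))"

lemma Pair_distr_measurable:
  assumes [measurable]: "K \<in> borel \<rightarrow>\<^sub>M prob_algebra (borel :: real measure)"
  shows "(\<lambda>x. distr (K x) borel (Pair x)) \<in>
    borel \<rightarrow>\<^sub>M subprob_algebra (borel :: (real \<times> real) measure)"
proof -
  have "K \<in> borel \<rightarrow>\<^sub>M subprob_algebra borel"
    by (rule measurable_prob_algebraD) measurable
  then show ?thesis
    by (rule measurable_distr2[rotated]) (auto simp: borel_prod)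
qed

lemma emeasure_kernel_coupling:
  assumes sets: "sets \<mu> = sets borel" and [measurable]: "K \<in> borel \<rightarrow>\<^sub>M prob_algebra borel"
    and A [measurable]: "A \<in> sets borel"
  shows "emeasure (kernel_coupling \<mu> K) A = (\<integral>\<^sup>+x. emeasure (K x) {y. (x, y) \<in> A} \<partial>\<mu>)"
proof -
  have space: "space \<mu> = UNIV"
    using sets_eq_imp_space_eq[OF sets] by simp
  have m: "(\<lambda>x. distr (K x) borel (Pair x)) \<in> \<mu> \<rightarrow>\<^sub>M subprob_algebra borel"
    using Pair_distr_measurable[OF assms(2)] measurable_cong_sets[OF sets refl] by blast
  have K: "sets (K x) = sets borel" for x
    using measurable_space[OF assms(2), of x] by (simp add: space_prob_algebra)
  have Pm: "Pair x \<in> K x \<rightarrow>\<^sub>M borel" for x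
    unfolding measurable_cong_sets[OF K refl] borel_prod[symmetric] by measurable
  have "emeasure (kernel_coupling \<mu> K) A = (\<integral>\<^sup>+x. emeasure (distr (K x) borel (Pair x)) A \<partial>\<mu>)"
    unfolding kernel_coupling_def by (rule emeasure_bind[OF _ m A]) (simp add: space)
  also have "\<dots> = (\<integral>\<^sup>+x. emeasure (K x) {y. (x, y) \<in> A} \<partial>\<mu>)"
    using sets_eq_imp_space_eq[OF K]
    by (intro nn_integral_cong) (simp add: emeasure_distr[OF Pm A] vimage_def)
  finally show ?thesis .
qed

definition disintegration :: "(real \<times> real) measure \<Rightarrow> real measure \<Rightarrow> (real \<Rightarrow> real measure) \<Rightarrow> bool" where
  "disintegration \<pi> \<mu> K \<longleftrightarrow> K \<in> borel \<rightarrow>\<^sub>M prob_algebra borel \<and> \<pi> = kernel_coupling \<mu> K"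

text \<open>Integrability is required explicitly because the Bochner integral of a
  non-integrable function is \<open>0\<close> by convention.\<close>

definition martingale_coupling ::
  "real measure \<Rightarrow> real measure \<Rightarrow> (real \<times> real) measure \<Rightarrow> bool" where
  "martingale_coupling \<mu> \<nu> \<pi> \<longleftrightarrow>
     sets \<pi> = sets borel \<and> prob_space \<pi> \<and>
     distr \<pi> borel fst = \<mu> \<and> distr \<pi> borel snd = \<nu> \<and>
     (\<exists>K. disintegration \<pi> \<mu> K \<and>
          (AE x in \<mu>. integrable (K x) (\<lambda>y. y) \<and> (\<integral>y. y \<partial>K x) = x))"

definition Gamma_set :: "real \<Rightarrow> (real \<times> real) set" where
  "Gamma_set k = {(x, y). y \<ge> x - k}"

definition M_set :: "real \<Rightarrow> real measure \<Rightarrow> real measure \<Rightarrow> (real \<times> real) measure set" where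
  "M_set k \<mu> \<nu> = {\<pi>. martingale_coupling \<mu> \<nu> \<pi> \<and> emeasure \<pi> (Gamma_set k) = 1}"

definition left_monotone :: "(real \<times> real) measure \<Rightarrow> bool" where
  "left_monotone \<pi> \<longleftrightarrow>
     (\<exists>S \<in> sets borel. emeasure \<pi> S = 1 \<and>
        \<not> (\<exists>x x' ym yp y'. (x, ym) \<in> S \<and> (x, yp) \<in> S \<and> (x', y') \<in> S \<and>
              x < x' \<and> ym < y' \<and> y' < yp))"

text \<open>Uniqueness is part of the definition: \<open>\<pi>\<close> is \<^emph>\<open>the\<close> left-monotone martingale coupling.\<close>

definition is_left_curtain :: "real measure \<Rightarrow> real measure \<Rightarrow> (real \<times> real) measure \<Rightarrow> bool" where
  "is_left_curtain \<mu> \<nu> \<pi> \<longleftrightarrow>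
     martingale_coupling \<mu> \<nu> \<pi> \<and> left_monotone \<pi> \<and>
     (\<forall>\<pi>'. martingale_coupling \<mu> \<nu> \<pi>' \<and> left_monotone \<pi>' \<longrightarrow> \<pi>' = \<pi>)"

abbreviation mu_unif :: "real measure" where
  "mu_unif \<equiv> uniform_measure lborel {-1..1}"

abbreviation nu_unif :: "real measure" where
  "nu_unif \<equiv> uniform_measure lborel {-2..2}"

definition D_lc :: "real \<Rightarrow> real" where
  "D_lc x = - x / 2 - 3 / 2"

definition U_lc :: "real \<Rightarrow> real" where
  "U_lc x = 3 * x / 2 + 1 / 2"

definition q_lc :: "real \<Rightarrow> real" where
  "q_lc x = 3 / 4"

text \<open>The law of \<open>u\<close> with probability \<open>q\<close> and \<open>d\<close> with probability \<open>1 - q\<close>, that is,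
  \<open>(1 - q) \<delta>\<^sub>d + q \<delta>\<^sub>u\<close> for \<open>q\<close> in \<open>[0, 1]\<close>; see \<open>emeasure_two_point\<close>.\<close>

definition two_point :: "real \<Rightarrow> real \<Rightarrow> real \<Rightarrow> real measure" where
  "two_point q d u = distr (measure_pmf (bernoulli_pmf q)) borel (\<lambda>b. if b then u else d)"

definition K_lc :: "real \<Rightarrow> real measure" where
  "K_lc x = two_point (q_lc x) (D_lc x) (U_lc x)"

lemma emeasure_two_point:
  assumes "0 \<le> q" "q \<le> 1" and A: "A \<in> sets borel"
  shows "emeasure (two_point q d u) A =
    ennreal (1 - q) * emeasure (return borel d) A + ennreal q * emeasure (return borel u) A"
proof -
  have "emeasure (two_point q d u) A =
      (\<integral>\<^sup>+y. indicator A y \<partial>two_point q d u)"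
    using A by (simp add: two_point_def)
  also have "\<dots> = (\<integral>\<^sup>+b. indicator A (if b then u else d) \<partial>measure_pmf (bernoulli_pmf q))"
    unfolding two_point_def using A by (subst nn_integral_distr) auto
  also have "\<dots> = ennreal (1 - q) * indicator A d + ennreal q * indicator A u"
    using assms by (simp add: mult.commute add.commute)
  finally show ?thesis
    using A by simp
qed

lemma K_lc_kernel: "K_lc \<in> borel \<rightarrow>\<^sub>M prob_algebra borel"
proof (rule measurable_prob_algebraI)
  show "prob_space (K_lc x)" for x
    unfolding K_lc_def two_point_def by (intro prob_space.prob_space_distr measure_pmf.prob_space_axioms) auto
  have [measurable]: "D_lc \<in> borel_measurable borel" "U_lc \<in> borel_measurable borel"
    unfolding D_lc_def U_lc_def by measurable
  show "K_lc \<in> borel \<rightarrow>\<^sub>M subprob_algebra borel"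
  proof (rule measurable_subprob_algebra)
    show "subprob_space (K_lc x)" for x
      using \<open>\<And>x. prob_space (K_lc x)\<close> by (rule prob_space_imp_subprob_space)
    show "sets (K_lc x) = sets borel" for x
      by (simp add: K_lc_def two_point_def)
    show "(\<lambda>x. emeasure (K_lc x) A) \<in> borel_measurable borel" if [measurable]: "A \<in> sets borel" for A
      unfolding K_lc_def by (simp add: emeasure_two_point q_lc_def)
  qed
qed

definition pi_lc :: "(real \<times> real) measure" where
  "pi_lc = kernel_coupling mu_unif K_lc"

text \<open>\<open>h\<close> is a function on \<open>[-3, 3]\<close>; its values elsewhere are irrelevant and possibly
  non-measurable. The difference \<open>y - x\<close> lies in \<open>[-3, 3]\<close> almost surely under every coupling of
  the two marginals, so restricting the integral to that set loses nothing.\<close>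

definition cost :: "(real \<Rightarrow> real) \<Rightarrow> (real \<times> real) measure \<Rightarrow> real" where
  "cost h \<pi> = (LINT z:{(x, y). y - x \<in> {-3..3}}|\<pi>. h (snd z - fst z))"

end

theory Submission
  imports Defs
begin

text \<open>
  Write \<open>(X, Y)\<close> for the two coordinates under a martingale coupling, and \<open>D\<close>, \<open>U\<close> for
  \<open>D_lc\<close>, \<open>U_lc\<close>. The key fact is that under a left-monotone coupling the events \<open>X \<le> t\<close> and
  \<open>D t < Y < U t\<close> agree almost surely. Indeed, let \<open>V\<close> be the union of the intervals spanned by
  the fibres over points \<open>x \<le> t\<close>. Left monotonicity keeps the mass starting to the right of \<open>t\<close>
  out of \<open>V\<close>, and no fibre crosses the boundary of a component \<open>(a, b)\<close> of \<open>V\<close>. Hence \<open>\<mu>\<close>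
  restricted to \<open>(a, b) \<inter> [-1, t]\<close> and \<open>\<nu>\<close> restricted to \<open>(a, b)\<close> have the same mass and mean,
  which forces \<open>a = D t\<close> and \<open>b = U t\<close>; a component exists because the density of \<open>\<mu>\<close> exceeds
  that of \<open>\<nu>\<close>, so that not all fibres can be trivial. This determines the coupling on all
  quadrants, which gives uniqueness.

  For optimality, write \<open>h (y - x) = h (y - 1) + \<integral> h' (y - t) dt\<close> over \<open>t\<close> in \<open>[x, 1]\<close>. After
  exchanging integrals it suffices to minimise \<open>E [f Y; X \<le> t]\<close> for each \<open>t\<close>, where
  \<open>f y = h' (y - t)\<close> is convex. Subtracting the chord of \<open>f\<close> through \<open>D t\<close> and \<open>U t\<close>, whose
  contribution is fixed by the martingale property, leaves a function that is nonpositive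
  between \<open>D t\<close> and \<open>U t\<close> and nonnegative outside, so the minimum is attained when \<open>X \<le> t\<close> is the event
  \<open>D t < Y < U t\<close>.
\<close>

subsection \<open>Martingale couplings of the two uniform laws\<close>

lemma borel_measurable_fst_snd:
  "(fst :: real \<times> real \<Rightarrow> real) \<in> borel_measurable borel"
  "(snd :: real \<times> real \<Rightarrow> real) \<in> borel_measurable borel"
  unfolding borel_prod[symmetric] by measurable

lemma measure_uniform_Icc:
  assumes "l < u" "A \<in> sets borel"
  shows "measure (uniform_measure lborel {l..u}) A = measure lborel ({l..u} \<inter> A) / (u - l :: real)"
  using assms by (subst measure_uniform_measure) auto

lemma AE_uniform_Icc:
  assumes "l < u"
  shows "(AE x in uniform_measure lborel {l..u::real}. P x) \<longleftrightarrow> (AE x in lborel. x \<in> {l..u} \<longrightarrow> P x)"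
  using assms by (subst AE_uniform_measure) auto

lemma integral_uniform_Icc_Ioo:
  fixes a b l u :: real
  assumes "l < u" "l \<le> a" "a \<le> b" "b \<le> u"
  shows "(\<integral>x. indicator {a<..<b} x * x \<partial>uniform_measure lborel {l..u}) = (b\<^sup>2 - a\<^sup>2) / (2 * (u - l))"
proof -
  have ae: "AE x in lborel. indicator {l..u} x / (u - l) * (indicator {a<..<b} x * x)
        = 1 / (u - l) * (x ^ 1 * indicator {a..b} x)"
    using AE_lborel_singleton[of a] AE_lborel_singleton[of b]
    by eventually_elim (use assms in \<open>auto simp: indicator_def\<close>)
  have d: "uniform_measure lborel {l..u} = density lborel (\<lambda>x. ennreal (indicator {l..u} x / (u - l)))"
    unfolding uniform_measure_def
    using assms by (intro density_cong) (auto simp: indicator_def divide_ennreal[symmetric] ennreal_1[symmetric] simp del: ennreal_1)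
  have "(\<integral>x. indicator {a<..<b} x * x \<partial>uniform_measure lborel {l..u})
     = (\<integral>x. indicator {l..u} x / (u - l) * (indicator {a<..<b} x * x) \<partial>lborel)"
    unfolding d using assms by (subst integral_density) auto
  also have "\<dots> = (\<integral>x. 1 / (u - l) * (x ^ 1 * indicator {a..b} x) \<partial>lborel)"
    using ae by (intro integral_cong_AE) auto
  also have "\<dots> = (b\<^sup>2 - a\<^sup>2) / (2 * (u - l))"
  proof -
    have "(\<integral>x. x ^ 1 * indicator {a..b} x \<partial>lborel) = (b\<^sup>2 - a\<^sup>2) / 2"
      using assms integral_power[of a b 1] by (simp add: power2_eq_square)
    then show ?thesis
      by (simp only: integral_mult_right_zero) simp
  qed
  finally show ?thesis .
qed

section \<open>Almost-everywhere statements and integrals under a kernel coupling\<close>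

lemma sets_kernel_borel:
  "K \<in> borel \<rightarrow>\<^sub>M prob_algebra borel \<Longrightarrow> sets (K x) = sets borel" for K :: "real \<Rightarrow> real measure"
  using measurable_space[of K borel "prob_algebra borel" x] by (simp add: space_prob_algebra)

lemma measurable_Pair_kernel:
  "K \<in> borel \<rightarrow>\<^sub>M prob_algebra borel \<Longrightarrow> Pair x \<in> K x \<rightarrow>\<^sub>M borel" for K :: "real \<Rightarrow> real measure"
  unfolding measurable_cong_sets[OF sets_kernel_borel refl] borel_prod[symmetric] by measurable

lemma sets_kernel_coupling:
  assumes "sets \<mu> = sets borel" and K: "K \<in> borel \<rightarrow>\<^sub>M prob_algebra borel"
  shows "sets (kernel_coupling \<mu> K) = sets borel"
  unfolding kernel_coupling_def
  using sets_eq_imp_space_eq[OF assms(1)] by (intro sets_bind) auto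

lemma AE_kernel_coupling:
  assumes sets: "sets \<mu> = sets borel" and K: "K \<in> borel \<rightarrow>\<^sub>M prob_algebra borel"
    and P: "Measurable.pred borel P"
  shows "(AE z in kernel_coupling \<mu> K. P z) \<longleftrightarrow> (AE x in \<mu>. AE y in K x. P (x, y))"
proof -
  have m: "(\<lambda>x. distr (K x) borel (Pair x)) \<in> \<mu> \<rightarrow>\<^sub>M subprob_algebra borel"
    using Pair_distr_measurable[OF K] measurable_cong_sets[OF sets refl] by blast
  show ?thesis
    unfolding kernel_coupling_def AE_bind[OF m P]
    using P by (intro AE_cong AE_distr_iff measurable_Pair_kernel[OF K]) auto
qed

lemma nn_integral_kernel_coupling:
  assumes sets: "sets \<mu> = sets borel" and K: "K \<in> borel \<rightarrow>\<^sub>M prob_algebra borel"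
    and f: "f \<in> borel_measurable borel"
  shows "(\<integral>\<^sup>+z. f z \<partial>kernel_coupling \<mu> K) = (\<integral>\<^sup>+x. \<integral>\<^sup>+y. f (x, y) \<partial>K x \<partial>\<mu>)"
proof -
  have m: "(\<lambda>x. distr (K x) borel (Pair x)) \<in> \<mu> \<rightarrow>\<^sub>M subprob_algebra borel"
    using Pair_distr_measurable[OF K] measurable_cong_sets[OF sets refl] by blast
  show ?thesis
    unfolding kernel_coupling_def nn_integral_bind[OF f m]
    using f by (intro nn_integral_cong nn_integral_distr measurable_Pair_kernel[OF K]) simp
qed

locale unif_martingale_coupling =
  fixes \<pi> :: "(real \<times> real) measure"
  assumes mc: "martingale_coupling mu_unif nu_unif \<pi>"

sublocale unif_martingale_coupling \<subseteq> prob_space \<pi>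
  using mc by (simp add: martingale_coupling_def)

context unif_martingale_coupling
begin

lemma sets_pi [measurable_cong]: "sets \<pi> = sets borel"
  using mc by (simp add: martingale_coupling_def)

lemma space_pi: "space \<pi> = UNIV"
  using sets_eq_imp_space_eq[OF sets_pi] by simp

lemma borel_measurable_fst_pi [measurable]: "fst \<in> \<pi> \<rightarrow>\<^sub>M borel"
  and borel_measurable_snd_pi [measurable]: "snd \<in> \<pi> \<rightarrow>\<^sub>M borel"
  unfolding measurable_cong_sets[OF sets_pi refl] by (rule borel_measurable_fst_snd)+

lemma distr_fst: "distr \<pi> borel fst = mu_unif" and distr_snd: "distr \<pi> borel snd = nu_unif"
  using mc by (simp_all add: martingale_coupling_def)

lemma AE_fst: "AE x in mu_unif. P x \<Longrightarrow> AE z in \<pi>. P (fst z)"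
  unfolding distr_fst[symmetric] by (rule AE_distrD) measurable

lemma AE_snd: "AE x in nu_unif. P x \<Longrightarrow> AE z in \<pi>. P (snd z)"
  unfolding distr_snd[symmetric] by (rule AE_distrD) measurable

lemma AE_fst_Icc: "AE z in \<pi>. fst z \<in> {-1..1}"
  by (rule AE_fst) (simp add: AE_uniform_Icc)

lemma AE_snd_Icc: "AE z in \<pi>. snd z \<in> {-2..2}"
  by (rule AE_snd) (simp add: AE_uniform_Icc)

lemma AE_fst_neq: "AE z in \<pi>. fst z \<noteq> c"
  by (rule AE_fst) (use AE_lborel_singleton[of c] in \<open>simp add: AE_uniform_Icc eventually_mono\<close>)

lemma AE_snd_neq: "AE z in \<pi>. snd z \<noteq> c"
  by (rule AE_snd) (use AE_lborel_singleton[of c] in \<open>simp add: AE_uniform_Icc eventually_mono\<close>)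

lemma prob_fst: "A \<in> sets borel \<Longrightarrow> prob {z. fst z \<in> A} = measure lborel ({-1..1} \<inter> A) / 2"
  using measure_distr[of fst \<pi> borel A] by (simp add: distr_fst measure_uniform_Icc space_pi vimage_def)

lemma prob_snd: "A \<in> sets borel \<Longrightarrow> prob {z. snd z \<in> A} = measure lborel ({-2..2} \<inter> A) / 4"
  using measure_distr[of snd \<pi> borel A] by (simp add: distr_snd measure_uniform_Icc space_pi vimage_def)

lemma integral_fst_pi:
  "f \<in> borel_measurable borel \<Longrightarrow> (\<integral>z. f (fst z) \<partial>\<pi>) = (\<integral>x. f x \<partial>mu_unif)" for f :: "real \<Rightarrow> real"
  unfolding distr_fst[symmetric] by (subst integral_distr) auto

lemma integral_snd_pi:
  "f \<in> borel_measurable borel \<Longrightarrow> (\<integral>z. f (snd z) \<partial>\<pi>) = (\<integral>x. f x \<partial>nu_unif)" for f :: "real \<Rightarrow> real"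
  unfolding distr_snd[symmetric] by (subst integral_distr) auto

lemma obtain_kernel:
  obtains K where "K \<in> borel \<rightarrow>\<^sub>M prob_algebra borel" "\<pi> = kernel_coupling mu_unif K"
    "AE x in mu_unif. integrable (K x) (\<lambda>y. y) \<and> (\<integral>y. y \<partial>K x) = x"
  using mc unfolding martingale_coupling_def disintegration_def by blast

lemma integrable_indicator_fst: "A \<in> sets borel \<Longrightarrow> integrable \<pi> (\<lambda>z. indicator A (fst z) * fst z :: real)"
  by (rule integrable_const_bound[where B=1], rule AE_mp[OF AE_fst_Icc]) (auto simp: indicator_def)

lemma integrable_indicator_snd:
  "A \<in> sets borel \<Longrightarrow> integrable \<pi> (\<lambda>z. indicator A (fst z) * snd z :: real)"
  by (rule integrable_const_bound[where B=2], rule AE_mp[OF AE_snd_Icc]) (auto simp: indicator_def)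

lemma integrable_indicator_pi:
  "A \<in> sets borel \<Longrightarrow> integrable \<pi> (\<lambda>z. indicator A (fst z) :: real)"
  by (rule integrable_const_bound[where B=1]) (auto simp: indicator_def)

text \<open>Integrating the fibre means against \<open>mu_unif\<close> over \<open>A\<close> gives
  the identity. The coordinate \<open>snd\<close> is at least -2, so adding 2 makes the integrands
  nonnegative almost everywhere and \<open>nn_integral_kernel_coupling\<close> applies; the added
  mass is then subtracted on both sides.\<close>

lemma martingale_indicator:
  assumes [measurable]: "A \<in> sets borel"
  shows "(\<integral>z. indicator A (fst z) * snd z \<partial>\<pi>) = (\<integral>z. indicator A (fst z) * fst z \<partial>\<pi>)"
proof -
  obtain K where K[measurable]: "K \<in> borel \<rightarrow>\<^sub>M prob_algebra borel" and pi: "\<pi> = kernel_coupling mu_unif K"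
    and mart: "AE x in mu_unif. integrable (K x) (\<lambda>y. y) \<and> (\<integral>y. y \<partial>K x) = x"
    by (rule obtain_kernel)
  note [measurable] = borel_measurable_fst_snd
  have sets_mu: "sets mu_unif = sets borel"
    by simp
  have Kp: "prob_space (K x)" for x
    using measurable_space[OF K, of x] by (simp add: space_prob_algebra)
  have "AE x in mu_unif. AE y in K x. snd (x, y) \<in> {-2..2}"
    using AE_snd_Icc unfolding pi by (subst (asm) AE_kernel_coupling) auto
  then have ae: "AE x in mu_unif. (\<integral>\<^sup>+y. ennreal (indicator A x * (y + 2)) \<partial>K x) = (\<integral>\<^sup>+y. ennreal (indicator A x * (x + 2)) \<partial>K x)"
    using mart
  proof eventually_elim
    case (elim x)
    interpret K: prob_space "K x" by (rule Kp)
    have "(\<integral>\<^sup>+y. ennreal (indicator A x * (y + 2)) \<partial>K x) = ennreal (\<integral>y. indicator A x * (y + 2) \<partial>K x)"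
      using elim by (intro nn_integral_eq_integral) (auto elim!: eventually_mono simp: indicator_def)
    also have "(\<integral>y. indicator A x * (y + 2) \<partial>K x) = indicator A x * (x + 2)"
      using elim K.prob_space by simp
    finally show ?case by (simp add: K.emeasure_space_1)
  qed
  have meas: "(\<lambda>z. ennreal (indicator A (fst z) * (snd z + 2))) \<in> borel_measurable borel"
     "(\<lambda>z. ennreal (indicator A (fst z) * (fst z + 2))) \<in> borel_measurable (borel :: (real \<times> real) measure)"
    by measurable
  have eq: "(\<integral>\<^sup>+z. ennreal (indicator A (fst z) * (snd z + 2)) \<partial>\<pi>) = (\<integral>\<^sup>+z. ennreal (indicator A (fst z) * (fst z + 2)) \<partial>\<pi>)"
    unfolding pi nn_integral_kernel_coupling[OF sets_mu K meas(1)] nn_integral_kernel_coupling[OF sets_mu K meas(2)]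
    using ae by (intro nn_integral_cong_AE) simp
  have "(\<integral>z. indicator A (fst z) * (snd z + 2) \<partial>\<pi>)
      = enn2real (\<integral>\<^sup>+z. ennreal (indicator A (fst z) * (snd z + 2)) \<partial>\<pi>)"
    by (rule integral_eq_nn_integral, measurable, rule AE_mp[OF AE_snd_Icc]) (simp add: indicator_def)
  also have "\<dots> = (\<integral>z. indicator A (fst z) * (fst z + 2) \<partial>\<pi>)"
    unfolding eq
    by (rule integral_eq_nn_integral[symmetric], measurable, rule AE_mp[OF AE_fst_Icc]) (simp add: indicator_def)
  finally have "(\<integral>z. indicator A (fst z) * snd z + 2 * indicator A (fst z) \<partial>\<pi>)
      = (\<integral>z. indicator A (fst z) * fst z + 2 * indicator A (fst z) \<partial>\<pi>)"
    by (simp only: distrib_left mult.commute)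
  then show ?thesis
    using integrable_indicator_fst[of A] integrable_indicator_snd[of A] integrable_indicator_pi[of A]
    by (subst (asm) (1 2) Bochner_Integration.integral_add) auto
qed

end

subsection \<open>Left-monotone couplings\<close>

text \<open>A deviation from the mean that has one sign and integral zero vanishes almost
  everywhere. This shows that a fibre lying on one side of its mean is a Dirac mass.\<close>

lemma (in prob_space) AE_eq_expectation:
  fixes f :: "'a \<Rightarrow> real"
  assumes "integrable M f" "expectation f = c" "(AE y in M. c \<le> f y) \<or> (AE y in M. f y \<le> c)"
  shows "AE y in M. f y = c"
  using assms(3)
proof
  assume "AE y in M. c \<le> f y"
  then have "AE y in M. 0 \<le> f y - c"
    by eventually_elim simp
  then have "AE y in M. f y - c = 0"
    using assms(1,2) by (subst integral_nonneg_eq_0_iff_AE[symmetric]) (auto simp: prob_space)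
  then show ?thesis
    by eventually_elim simp
next
  assume "AE y in M. f y \<le> c"
  then have "AE y in M. 0 \<le> c - f y"
    by eventually_elim simp
  then have "AE y in M. c - f y = 0"
    using assms(1,2) by (subst integral_nonneg_eq_0_iff_AE[symmetric]) (auto simp: prob_space)
  then show ?thesis
    by eventually_elim simp
qed

text \<open>The endpoints are the last point outside \<open>V\<close> to the left of
  \<open>x\<close> and the first to the right. Both exist because the complement of \<open>V\<close>
  is closed, and \<open>l\<close> and \<open>u\<close> make the two search sets nonempty and
  bounded.\<close>

lemma open_real_component:
  fixes V :: "real set"
  assumes "open V" "x \<in> V" "l \<notin> V" "u \<notin> V" "l < x" "x < u"
  obtains a b where "a < x" "x < b" "a \<notin> V" "b \<notin> V" "{a<..<b} \<subseteq> V" "l \<le> a" "b \<le> u"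
proof -
  define L where "L = {l..x} - V"
  define R where "R = {x..u} - V"
  have L: "closed L" "L \<noteq> {}" "bdd_above L"
    using assms closed_Diff[of "{l..x}" V] unfolding L_def
    by (auto intro!: bdd_aboveI[of _ x] simp: subset_eq dest: bspec[of _ _ l])
  have R: "closed R" "R \<noteq> {}" "bdd_below R"
    using assms closed_Diff[of "{x..u}" V] unfolding R_def
    by (auto intro!: bdd_belowI[of _ x] simp: subset_eq dest: bspec[of _ _ u])
  have SL: "Sup L \<in> L" and IR: "Inf R \<in> R"
    using closed_contains_Sup[of L] closed_contains_Inf[of R] L R by auto
  have "y \<in> V" if "Sup L < y" "y < Inf R" for y
  proof (rule ccontr)
    assume "y \<notin> V"
    then have "y \<in> L \<or> y \<in> R"
      using that SL IR unfolding L_def R_def by auto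
    then show False
      using that cSup_upper[of y L] cInf_lower[of y R] L R by auto
  qed
  then show ?thesis
    using SL IR assms by (intro that[of "Sup L" "Inf R"]) (auto simp: L_def R_def order.strict_iff_order)
qed

context unif_martingale_coupling
begin

text \<open>A Dirac fibre spans no interval and so adds nothing to \<open>V\<close>; the proof
  therefore separates such fibres from those with points strictly on both sides of their mean
  (\<open>nd\<close>).\<close>

lemma left_monotone_cut:
  assumes lm: "left_monotone \<pi>" and t: "-1 < t" "t \<le> 1"
  shows "AE z in \<pi>. fst z \<le> t \<longleftrightarrow> snd z \<in> {D_lc t<..<U_lc t}"
proof -
  obtain K where K: "K \<in> borel \<rightarrow>\<^sub>M prob_algebra borel" and pi: "\<pi> = kernel_coupling mu_unif K"
    and mart: "AE x in mu_unif. integrable (K x) (\<lambda>y. y) \<and> (\<integral>y. y \<partial>K x) = x"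
    by (rule obtain_kernel)
  have Kp: "prob_space (K x)" for x
    using measurable_space[OF K, of x] by (simp add: space_prob_algebra)
  have sets_mu: "sets mu_unif = sets borel"
    by simp
  have Ks: "sets (K x) = sets borel" for x
    by (rule sets_kernel_borel[OF K])
  obtain S where S [measurable]: "S \<in> sets borel" and S1: "emeasure \<pi> S = 1"
    and mono: "\<And>x x' ym yp y'. (x, ym) \<in> S \<Longrightarrow> (x, yp) \<in> S \<Longrightarrow> (x', y') \<in> S \<Longrightarrow>
      x < x' \<Longrightarrow> ym < y' \<Longrightarrow> y' < yp \<Longrightarrow> False"
    using lm unfolding left_monotone_def by blast
  have AE_S: "AE z in \<pi>. z \<in> S"
    using S1 by (intro AE_prob_1) (simp add: measure_def)
  note [measurable] = borel_measurable_fst_snd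
  define d where "d x = emeasure (K x) {x}" for x
  \<comment> \<open>The set \<open>{x}\<close> moves with \<open>x\<close>. Pushing the fibre into
    the plane replaces it by the fixed diagonal, which makes measurability of \<open>d\<close>
    available.\<close>
  have d_eq: "d x = emeasure (distr (K x) borel (Pair x)) {z. snd z = fst z}" for x
    unfolding d_def using sets_eq_imp_space_eq[OF Ks[of x]]
    by (subst emeasure_distr[OF measurable_Pair_kernel[OF K]]) (auto simp: vimage_def)
  have [measurable]: "d \<in> borel_measurable borel"
    unfolding d_eq[abs_def]
    by (rule measurable_compose[OF Pair_distr_measurable[OF K] measurable_emeasure_subprob_algebra]) measurable
  have [measurable]: "Measurable.pred borel (\<lambda>z :: real \<times> real. snd z = fst z \<or> d (fst z) \<noteq> 1)"
    by measurable
  have "AE y in K x. y = x" if "d x = 1" for x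
    using prob_space.AE_prob_1[OF Kp, of x "{x}"] that by (simp add: d_def measure_def)
  then have "AE x in mu_unif. AE y in K x. snd (x, y) = fst (x, y) \<or> d (fst (x, y)) \<noteq> 1"
    by (intro always_eventually) auto
  then have AE_deg: "AE z in \<pi>. snd z = fst z \<or> d (fst z) \<noteq> 1"
    unfolding pi by (subst AE_kernel_coupling[OF sets_mu K]) auto

  \<comment> \<open>Bounding \<open>snd\<close> keeps \<open>V\<close> inside (-2, 2). The last
    condition strips Dirac fibres of stray off-diagonal points, which are negligible for the measure
    but could otherwise enlarge \<open>V\<close>.\<close>
  define S' where "S' = {z. z \<in> S \<and> snd z \<in> {-2..2} \<and> (snd z = fst z \<or> d (fst z) \<noteq> 1)}"
  have S'[measurable]: "S' \<in> sets borel"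
    unfolding S'_def by measurable
  have AE_S': "AE z in \<pi>. z \<in> S'"
    using AE_S AE_snd_Icc AE_deg unfolding S'_def by eventually_elim auto
  define good where "good x \<longleftrightarrow> integrable (K x) (\<lambda>y. y) \<and> (\<integral>y. y \<partial>K x) = x \<and> (AE y in K x. (x, y) \<in> S')" for x
  have "AE x in mu_unif. AE y in K x. (x, y) \<in> S'"
    using AE_S' unfolding pi by (subst (asm) AE_kernel_coupling[OF sets_mu K]) auto
  with mart have "AE x in mu_unif. good x"
    unfolding good_def by eventually_elim auto
  then have AE_good: "AE z in \<pi>. good (fst z) \<and> (fst z, snd z) \<in> S'"
    using AE_fst[of good] AE_S' by auto
  define nd where "nd x \<longleftrightarrow> (\<exists>ym yp. (x, ym) \<in> S' \<and> (x, yp) \<in> S' \<and> ym < x \<and> x < yp)" for x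
  \<comment> \<open>With no points on both sides of \<open>x\<close>, the fibre lies on one side of
    its mean, so it is a Dirac mass at \<open>x\<close>, and \<open>S'\<close> keeps only the
    diagonal point over \<open>x\<close>.\<close>
  have deg: "y = x" if "good x" "\<not> nd x" "(x, y) \<in> S'" for x y
  proof -
    interpret Kx: prob_space "K x"
      by (rule Kp)
    have "(\<forall>y. (x, y) \<in> S' \<longrightarrow> x \<le> y) \<or> (\<forall>y. (x, y) \<in> S' \<longrightarrow> y \<le> x)"
      using \<open>\<not> nd x\<close> unfolding nd_def by (meson not_le)
    then have "(AE y in K x. x \<le> y) \<or> (AE y in K x. y \<le> x)"
      using \<open>good x\<close> unfolding good_def by (meson eventually_mono)
    then have "AE y in K x. y = x"
      using \<open>good x\<close> by (intro Kx.AE_eq_expectation) (auto simp: good_def)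
    then have "d x = 1"
      unfolding d_def by (intro Kx.emeasure_eq_1_AE) (auto simp: Ks)
    then show ?thesis
      using \<open>(x, y) \<in> S'\<close> by (auto simp: S'_def)
  qed

  define V where "V = \<Union>{{ym<..<yp} |x ym yp. x \<le> t \<and> (x, ym) \<in> S' \<and> (x, yp) \<in> S'}"
  have "open V"
    unfolding V_def by (intro open_Union) auto
  have V_box: "V \<subseteq> {-2<..<2}"
    unfolding V_def S'_def by auto
  have seg: "v \<in> V" if "x \<le> t" "(x, ym) \<in> S'" "(x, yp) \<in> S'" "ym < v" "v < yp" for x ym yp v
  proof -
    have "{ym<..<yp} \<subseteq> V"
      unfolding V_def using that by (intro Union_upper) blast
    then show ?thesis
      using that by auto
  qed
  have notV: "y \<notin> V" if "t < x" "(x, y) \<in> S'" for x y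
  proof
    assume "y \<in> V"
    then obtain x' ym yp where "x' \<le> t" "(x', ym) \<in> S'" "(x', yp) \<in> S'" "ym < y" "y < yp"
      unfolding V_def by auto
    then show False
      using that mono[of x' ym yp x y] by (simp add: S'_def)
  qed
  have nd_V: "x \<in> V" if "x \<le> t" "nd x" for x
    using seg that unfolding nd_def by blast
  \<comment> \<open>A nondegenerate fibre also has a point of \<open>S'\<close> on the other side of
    \<open>x\<close>. Hence \<open>V\<close> contains \<open>x\<close> itself and everything from
    \<open>x\<close> up to, but excluding, \<open>y\<close>.\<close>
  have seg_nd: "v \<in> V" if "x \<le> t" "nd x" "(x, y) \<in> S'" "x \<le> v \<and> v < y \<or> y < v \<and> v \<le> x" for x y v
  proof -
    obtain ym yp where "(x, ym) \<in> S'" "(x, yp) \<in> S'" "ym < x" "x < yp"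
      using \<open>nd x\<close> unfolding nd_def by auto
    then show ?thesis
      using seg[of x ym y v] seg[of x y yp v] that by auto
  qed

  \<comment> \<open>If every fibre over (-1, t] were trivial, \<open>snd\<close> would carry all the
    mass of \<open>fst\<close> in (-1, t], giving (t + 1)/2 \<le> (t + 1)/4.\<close>
  have "\<exists>x. -1 < x \<and> x \<le> t \<and> nd x"
  proof (rule ccontr)
    assume none: "\<not> ?thesis"
    have "AE z in \<pi>. z \<in> {z. fst z \<in> {-1<..t}} \<longrightarrow> z \<in> {z. snd z \<in> {-1<..t}}"
      using AE_good
    proof eventually_elim
      case (elim z)
      then show ?case
        using none deg[of "fst z" "snd z"] by auto
    qed
    then have "prob {z. fst z \<in> {-1<..t}} \<le> prob {z. snd z \<in> {-1<..t}}"
      by (intro finite_measure_mono_AE) measurable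
    moreover have "{-1..1} \<inter> {-1<..t} = {-1<..t}" "{-2..2} \<inter> {-1<..t} = {-1<..t}"
      using t by auto
    ultimately show False
      using t by (simp add: prob_fst prob_snd del: greaterThanAtMost_iff)
  qed
  then obtain x0 where x0: "-1 < x0" "x0 \<le> t" "nd x0"
    by blast
  have box: "-2 \<notin> V" "2 \<notin> V" "-2 < x0" "x0 < 2"
    using V_box x0 t by auto
  obtain a b where ab: "a < x0" "x0 < b" "a \<notin> V" "b \<notin> V" "{a<..<b} \<subseteq> V" "-2 \<le> a" "b \<le> 2"
    by (rule open_real_component[OF \<open>open V\<close> nd_V[OF x0(2,3)] box])

  \<comment> \<open>Starting points range over the part of (a, b) inside the support of
    \<open>mu_unif\<close> and to the left of \<open>t\<close>.\<close>
  define l where "l = max a (-1)"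
  define r where "r = min b t"
  have lr: "-1 \<le> l" "l < r" "r \<le> 1"
    using x0 ab t by (auto simp: l_def r_def)
  \<comment> \<open>A nondegenerate fibre over \<open>x < t\<close> that crossed \<open>a\<close> or
    \<open>b\<close> would put that endpoint into \<open>V\<close>. Starting points beyond
    \<open>t\<close> are excluded from (a, b) by \<open>notV\<close>.\<close>
  have iff: "AE z in \<pi>. fst z \<in> {l<..<r} \<longleftrightarrow> snd z \<in> {a<..<b}"
    using AE_good AE_fst_Icc AE_fst_neq[of "-1"] AE_fst_neq[of t] AE_fst_neq[of a] AE_fst_neq[of b]
      AE_snd_neq[of a] AE_snd_neq[of b]
  proof eventually_elim
    case (elim z)
    obtain x y where z: "z = (x, y)"
      by fastforce
    have xy: "(x, y) \<in> S'" "good x" "x \<noteq> -1" "x \<noteq> t" "x \<noteq> a" "x \<noteq> b" "y \<noteq> a" "y \<noteq> b" "-1 \<le> x"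
      using elim by (auto simp: z)
    show ?case
    proof
      assume "fst z \<in> {l<..<r}"
      then have x: "a < x" "x < b" "x < t"
        by (auto simp: z l_def r_def)
      show "snd z \<in> {a<..<b}"
      proof (cases "nd x")
        case True
        then show ?thesis
          using seg_nd[of x y a] seg_nd[of x y b] x xy ab by (force simp: z)
      next
        case False
        then show ?thesis
          using deg[of x y] x xy by (simp add: z)
      qed
    next
      assume "snd z \<in> {a<..<b}"
      then have y: "a < y" "y < b"
        by (auto simp: z)
      then have "x < t"
        using notV[of x y] ab xy by (cases "x < t") auto
      moreover have "a < x \<and> x < b"
      proof (cases "nd x")
        case True
        then show ?thesis
          using seg_nd[of x y a] seg_nd[of x y b] \<open>x < t\<close> y xy ab by force
      next
        case False
        then show ?thesis
          using deg[of x y] y xy by simp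
      qed
      ultimately show "fst z \<in> {l<..<r}"
        using xy by (auto simp: z l_def r_def)
    qed
  qed
  have "prob {z. fst z \<in> {l<..<r}} = prob {z. snd z \<in> {a<..<b}}"
    using iff by (intro finite_measure_eq_AE) (auto, measurable)
  moreover have "{-1..1} \<inter> {l<..<r} = {l<..<r}" "{-2..2} \<inter> {a<..<b} = {a<..<b}"
    using lr ab by auto
  ultimately have mass: "2 * (r - l) = b - a"
    using lr ab by (simp add: prob_fst prob_snd del: greaterThanLessThan_iff)
  \<comment> \<open>Besides the mass, the first moment is preserved, by the martingale property.
    After cancelling the common length, this says that the two intervals have the same
    midpoint.\<close>
  have "(\<integral>z. indicator {l<..<r} (fst z) * fst z \<partial>\<pi>) = (\<integral>z. indicator {l<..<r} (fst z) * snd z \<partial>\<pi>)"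
    by (rule martingale_indicator[symmetric]) simp
  also have "\<dots> = (\<integral>z. indicator {a<..<b} (snd z) * snd z \<partial>\<pi>)"
    using iff by (intro integral_cong_AE) (auto elim!: eventually_mono simp: indicator_def)
  finally have "(r\<^sup>2 - l\<^sup>2) / 4 = (b\<^sup>2 - a\<^sup>2) / 8"
    using lr ab integral_fst_pi[of "\<lambda>x. indicator {l<..<r} x * x"] integral_snd_pi[of "\<lambda>x. indicator {a<..<b} x * x"]
    by (simp add: integral_uniform_Icc_Ioo)
  moreover have "2 * p = q" if "p / 4 = q / 8" for p q :: real
    using that by simp
  ultimately have "2 * (r\<^sup>2 - l\<^sup>2) = b\<^sup>2 - a\<^sup>2"
    by blast
  then have "2 * ((r - l) * (r + l)) = (b - a) * (b + a)"
    by (simp add: power2_eq_square algebra_simps)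
  then have "(b - a) * (r + l) = (b - a) * (b + a)"
    unfolding mass[symmetric] by (simp only: mult.assoc)
  then have centre: "r + l = b + a"
    using ab by simp
  \<comment> \<open>\<open>{l<..<r}\<close> has half the length and the same centre as \<open>{a<..<b}\<close>, so they share no endpoint.\<close>
  have "r = t" "l = -1"
    using mass centre lr unfolding l_def r_def by (auto simp: min_def max_def split: if_splits)
  \<comment> \<open>Now b - a = 2 (t + 1) and b + a = t - 1, which is solved by the two
    formulas.\<close>
  then have "a = D_lc t" "b = U_lc t"
    using mass centre by (simp_all add: D_lc_def U_lc_def)
  with iff \<open>r = t\<close> \<open>l = -1\<close> have "AE z in \<pi>. fst z \<in> {-1<..<t} \<longleftrightarrow> snd z \<in> {D_lc t<..<U_lc t}"
    by simp
  then show ?thesis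
    using AE_fst_Icc AE_fst_neq[of "-1"] AE_fst_neq[of t]
    by eventually_elim auto
qed

end

subsection \<open>The coupling \<open>pi_lc\<close>\<close>

lemma AE_K_lc:
  assumes [measurable]: "Measurable.pred borel P"
  shows "(AE y in K_lc x. P y) \<longleftrightarrow> P (D_lc x) \<and> P (U_lc x)"
  unfolding K_lc_def two_point_def
  by (subst AE_distr_iff) (auto simp: AE_measure_pmf_iff q_lc_def)

lemma measurable_lc [measurable]: "D_lc \<in> borel_measurable borel" "U_lc \<in> borel_measurable borel"
  unfolding D_lc_def U_lc_def by measurable

lemma AE_pi_lc:
  assumes [measurable]: "Measurable.pred borel P"
  shows "(AE z in pi_lc. P z) \<longleftrightarrow> (AE x in mu_unif. P (x, D_lc x) \<and> P (x, U_lc x))"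
proof -
  have "Measurable.pred borel (\<lambda>y. P (x, y))" for x
    by (rule measurable_compose[OF _ assms]) (simp add: borel_prod[symmetric])
  then show ?thesis
    unfolding pi_lc_def by (subst AE_kernel_coupling[OF _ K_lc_kernel]) (auto simp: AE_K_lc)
qed

lemma sets_pi_lc: "sets pi_lc = sets borel"
  unfolding pi_lc_def by (rule sets_kernel_coupling[OF _ K_lc_kernel]) simp

lemma distr_pi_lc_fst: "distr pi_lc borel fst = mu_unif"
proof (rule measure_eqI)
  fix A assume "A \<in> sets (distr pi_lc borel fst)"
  then have A [measurable]: "A \<in> sets borel"
    by simp
  have B: "{z :: real \<times> real. fst z \<in> A} \<in> sets borel"
    using borel_measurable_fst_snd(1) by measurable
  have f: "fst \<in> pi_lc \<rightarrow>\<^sub>M borel"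
    unfolding measurable_cong_sets[OF sets_pi_lc refl] by (rule borel_measurable_fst_snd)
  have p: "prob_space (K_lc x)" for x
    using measurable_space[OF K_lc_kernel, of x] by (simp add: space_prob_algebra)
  have K1: "emeasure (K_lc x) UNIV = 1" for x
    using prob_space.emeasure_space_1[OF p, of x] sets_eq_imp_space_eq[OF sets_kernel_borel[OF K_lc_kernel], of x] by simp
  have "emeasure (distr pi_lc borel fst) A = emeasure pi_lc {z. fst z \<in> A}"
    using sets_eq_imp_space_eq[OF sets_pi_lc] by (simp add: emeasure_distr[OF f A] vimage_def)
  also have "\<dots> = (\<integral>\<^sup>+x. emeasure (K_lc x) {y. x \<in> A} \<partial>mu_unif)"
    unfolding pi_lc_def by (subst emeasure_kernel_coupling[OF _ K_lc_kernel B]) simp_all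
  also have "\<dots> = (\<integral>\<^sup>+x. indicator A x \<partial>mu_unif)"
    by (intro nn_integral_cong) (simp add: indicator_def K1)
  finally show "emeasure (distr pi_lc borel fst) A = emeasure mu_unif A"
    by simp
qed simp

text \<open>\<open>D_lc\<close> maps [-1, 1] onto [-2, -1] with slope -1/2 and weight 1/4;
  \<open>U_lc\<close> maps it onto [-1, 2] with slope 3/2 and weight 3/4. In both cases (1/2) times
  the weight over the absolute slope is 1/4, the density of \<open>nu_unif\<close>.\<close>

lemma distr_pi_lc_snd: "distr pi_lc borel snd = nu_unif"
proof (rule measure_eqI)
  fix A assume "A \<in> sets (distr pi_lc borel snd)"
  then have A [measurable]: "A \<in> sets borel"
    by simp
  have B: "{z :: real \<times> real. snd z \<in> A} \<in> sets borel"
    using borel_measurable_fst_snd(2) by measurable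
  have f: "snd \<in> pi_lc \<rightarrow>\<^sub>M borel"
    unfolding measurable_cong_sets[OF sets_pi_lc refl] by (rule borel_measurable_fst_snd)
  define p where "p = (\<integral>\<^sup>+x. indicator A (D_lc x) * indicator {-1..1} x \<partial>lborel)"
  define q where "q = (\<integral>\<^sup>+x. indicator A (U_lc x) * indicator {-1..1} x \<partial>lborel)"
  have D: "emeasure lborel (A \<inter> {-2..-1}) = ennreal (1/2) * p"
  proof -
    have "(\<integral>\<^sup>+y. indicator (A \<inter> {-2..-1}) y \<partial>lborel)
        = ennreal \<bar>- 1 / 2\<bar> * (\<integral>\<^sup>+x. indicator (A \<inter> {-2..-1}) (- 3 / 2 + (- 1 / 2) * x) \<partial>lborel)"
      by (rule nn_integral_real_affine) auto
    also have "(\<integral>\<^sup>+x. indicator (A \<inter> {-2..-1}) (- 3 / 2 + (- 1 / 2) * x) \<partial>lborel) = p"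
      unfolding p_def by (intro nn_integral_cong) (auto simp: indicator_def D_lc_def algebra_simps)
    finally show ?thesis
      by simp
  qed
  have U: "emeasure lborel (A \<inter> {-1..2}) = ennreal (3/2) * q"
  proof -
    have "(\<integral>\<^sup>+y. indicator (A \<inter> {-1..2}) y \<partial>lborel)
        = ennreal \<bar>3 / 2\<bar> * (\<integral>\<^sup>+x. indicator (A \<inter> {-1..2}) (1 / 2 + (3 / 2) * x) \<partial>lborel)"
      by (rule nn_integral_real_affine) auto
    also have "(\<integral>\<^sup>+x. indicator (A \<inter> {-1..2}) (1 / 2 + (3 / 2) * x) \<partial>lborel) = q"
      unfolding q_def by (intro nn_integral_cong) (auto simp: indicator_def U_lc_def algebra_simps)
    finally show ?thesis
      by simp
  qed
  have "emeasure (distr pi_lc borel snd) A = emeasure pi_lc {z. snd z \<in> A}"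
    using sets_eq_imp_space_eq[OF sets_pi_lc] by (simp add: emeasure_distr[OF f A] vimage_def)
  also have "\<dots> = (\<integral>\<^sup>+x. emeasure (K_lc x) A \<partial>mu_unif)"
    unfolding pi_lc_def by (subst emeasure_kernel_coupling[OF _ K_lc_kernel B]) simp_all
  also have "\<dots> = (\<integral>\<^sup>+x. ennreal (1/4) * indicator A (D_lc x) + ennreal (3/4) * indicator A (U_lc x) \<partial>mu_unif)"
    unfolding K_lc_def by (simp add: emeasure_two_point q_lc_def)
  also have "\<dots> = (\<integral>\<^sup>+x. ennreal (1/4) * (indicator A (D_lc x) * indicator {-1..1} x)
      + ennreal (3/4) * (indicator A (U_lc x) * indicator {-1..1} x) \<partial>lborel) / 2"
    by (subst nn_integral_uniform_measure) (auto simp: distrib_right mult.assoc)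
  also have "(\<integral>\<^sup>+x. ennreal (1/4) * (indicator A (D_lc x) * indicator {-1..1} x)
      + ennreal (3/4) * (indicator A (U_lc x) * indicator {-1..1} x) \<partial>lborel)
      = ennreal (1/4) * p + ennreal (3/4) * q"
    unfolding p_def q_def by (subst nn_integral_add) (auto simp: nn_integral_cmult)
  also have "(ennreal (1/4) * p + ennreal (3/4) * q) / 2 = (ennreal (1/2) * p + ennreal (3/2) * q) / 4"
  proof -
    have "ennreal (1/2) * p = ennreal 2 * (ennreal (1/4) * p)" "ennreal (3/2) * q = ennreal 2 * (ennreal (3/4) * q)"
      by (simp_all only: mult.assoc[symmetric] ennreal_mult[symmetric]) simp_all
    then have *: "ennreal (1/2) * p + ennreal (3/2) * q = ennreal 2 * (ennreal (1/4) * p + ennreal (3/4) * q)"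
      by (simp only: distrib_left)
    have "z / ennreal 2 = ennreal 2 * z / ennreal 4" for z
    proof (cases z)
      case (real r)
      then show ?thesis
        by (simp only: ennreal_mult[symmetric] divide_ennreal) (simp add: divide_ennreal ennreal_mult[symmetric] del: ennreal_numeral)
    next
      case top
      then show ?thesis
        by (simp add: ennreal_mult_top ennreal_top_divide)
    qed
    then show ?thesis
      unfolding * by simp
  qed
  also have "ennreal (1/2) * p + ennreal (3/2) * q = emeasure lborel ({-2..2} \<inter> A)"
  proof -
    have "emeasure lborel ({-2..2} \<inter> A) = emeasure lborel ((A \<inter> {-2..-1}) \<union> (A \<inter> {-1<..2}))"
      by (rule arg_cong[where f="emeasure lborel"]) auto
    also have "\<dots> = emeasure lborel (A \<inter> {-2..-1}) + emeasure lborel (A \<inter> {-1<..2})"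
      by (rule plus_emeasure[symmetric]) auto
    also have "emeasure lborel (A \<inter> {-1<..2}) = emeasure lborel (A \<inter> {-1..2})"
      using AE_lborel_singleton[of "-1"] by (intro emeasure_eq_AE) (auto elim!: eventually_mono)
    finally show ?thesis
      unfolding D U by simp
  qed
  finally show "emeasure (distr pi_lc borel snd) A = emeasure nu_unif A"
    by simp
qed simp

lemma prob_space_pi_lc: "prob_space pi_lc"
proof (rule prob_space_distrD)
  show "fst \<in> pi_lc \<rightarrow>\<^sub>M borel"
    unfolding measurable_cong_sets[OF sets_pi_lc refl] by (rule borel_measurable_fst_snd)
  show "prob_space (distr pi_lc borel fst)"
    unfolding distr_pi_lc_fst by (rule prob_space_uniform_measure) auto
qed

lemma martingale_K_lc: "integrable (K_lc x) (\<lambda>y. y) \<and> (\<integral>y. y \<partial>K_lc x) = x"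
  unfolding K_lc_def two_point_def
  by (subst integrable_distr_eq, simp, simp, subst integral_distr)
    (auto intro: integrable_measure_pmf_finite simp: q_lc_def D_lc_def U_lc_def field_simps)

lemma martingale_coupling_pi_lc: "martingale_coupling mu_unif nu_unif pi_lc"
  unfolding martingale_coupling_def disintegration_def
  using sets_pi_lc prob_space_pi_lc distr_pi_lc_fst distr_pi_lc_snd K_lc_kernel martingale_K_lc
  by (auto simp: pi_lc_def[symmetric] intro!: exI[of _ K_lc])

interpretation lc: unif_martingale_coupling pi_lc
  by unfold_locales (rule martingale_coupling_pi_lc)

text \<open>On [-1, 1] the intervals from \<open>D_lc x\<close> to \<open>U_lc x\<close> grow with
  \<open>x\<close>, so the two points over a later \<open>x'\<close> lie outside every earlier open
  interval. Restricting \<open>S\<close> to this range guarantees \<open>D_lc x\<close> \<le>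
  \<open>U_lc x\<close>.\<close>

lemma left_monotone_pi_lc: "left_monotone pi_lc"
proof -
  define S where "S = {z. fst z \<in> {-1..1} \<and> (snd z = D_lc (fst z) \<or> snd z = U_lc (fst z))}"
  note [measurable] = borel_measurable_fst_snd
  have S: "S \<in> sets borel"
    unfolding S_def by measurable
  have "AE z in pi_lc. z \<in> S"
    using S by (subst AE_pi_lc) (auto simp: S_def AE_uniform_Icc)
  then have "emeasure pi_lc S = 1"
    using S by (intro lc.emeasure_eq_1_AE) (simp_all add: sets_pi_lc)
  moreover have False
    if "(x, ym) \<in> S" "(x, yp) \<in> S" "(x', y') \<in> S" "x < x'" "ym < y'" "y' < yp" for x x' ym yp y'
    using that by (auto simp: S_def D_lc_def U_lc_def field_simps)
  ultimately show ?thesis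
    unfolding left_monotone_def using S by blast
qed

section \<open>Uniqueness from the values on quadrants\<close>

lemma atMost_prod: "{..(t, s)} = {..t} \<times> {..s}" for t s :: real
  by (auto simp: less_eq_prod_def)

text \<open>If \<open>fst z \<le> t\<close> is almost surely an event about \<open>snd z\<close>,
  every quadrant probability is a value of \<open>nu_unif\<close>. Quadrants are stable under
  intersection and generate the Borel sets of the plane.\<close>

lemma coupling_eqI_cut:
  assumes "unif_martingale_coupling \<pi>" "unif_martingale_coupling \<rho>"
    and cut: "\<And>t. -1 < t \<Longrightarrow> t \<le> 1 \<Longrightarrow> AE z in \<pi>. fst z \<le> t \<longleftrightarrow> snd z \<in> I t"
      "\<And>t. -1 < t \<Longrightarrow> t \<le> 1 \<Longrightarrow> AE z in \<rho>. fst z \<le> t \<longleftrightarrow> snd z \<in> I t"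
    and I [measurable]: "\<And>t. I t \<in> sets borel"
  shows "\<pi> = \<rho>"
proof -
  have eq: "emeasure \<sigma> {..(t, s)} = (if t \<le> -1 then 0 else if t \<le> 1 then emeasure nu_unif (I t \<inter> {..s}) else emeasure nu_unif {..s})"
    if "unif_martingale_coupling \<sigma>" and cut: "\<And>t. -1 < t \<Longrightarrow> t \<le> 1 \<Longrightarrow> AE z in \<sigma>. fst z \<le> t \<longleftrightarrow> snd z \<in> I t"
    for \<sigma> t s
  proof -
    interpret unif_martingale_coupling \<sigma>
      by fact
    have E: "{..(t, s)} \<in> sets \<sigma>"
      unfolding sets_pi using closed_Times[OF closed_atMost[of t] closed_atMost[of s]]
      by (intro borel_closed) (simp add: atMost_prod)
    have nu: "emeasure nu_unif A = emeasure \<sigma> {z. snd z \<in> A}" if "A \<in> sets borel" for A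
      unfolding distr_snd[symmetric] using that by (simp add: emeasure_distr space_pi vimage_def)
    have m: "{z. snd z \<in> A} \<in> sets \<sigma>" if "A \<in> sets borel" for A
      using measurable_sets[OF borel_measurable_snd_pi that] by (simp add: space_pi vimage_def)
    have e1: "emeasure \<sigma> {..(t, s)} = emeasure \<sigma> {}" if "t \<le> -1"
      using AE_fst_Icc AE_fst_neq[of "-1"] that E by (intro emeasure_eq_AE) (auto elim!: eventually_elim2 simp: less_eq_prod_def)
    have e2: "emeasure \<sigma> {..(t, s)} = emeasure \<sigma> {z. snd z \<in> I t \<inter> {..s}}" if "-1 < t" "t \<le> 1"
      using cut[OF that] E m[of "I t \<inter> {..s}"] by (intro emeasure_eq_AE) (auto elim!: eventually_mono simp: less_eq_prod_def)
    have e3: "emeasure \<sigma> {..(t, s)} = emeasure \<sigma> {z. snd z \<in> {..s}}" if "1 < t"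
    proof -
      have "AE z in \<sigma>. z \<in> {..(t, s)} \<longleftrightarrow> z \<in> {z. snd z \<in> {..s}}"
        using AE_fst_Icc by eventually_elim (use that in \<open>auto simp: less_eq_prod_def\<close>)
      then show ?thesis
        using E m[of "{..s}"] by (intro emeasure_eq_AE) auto
    qed
    show ?thesis
      using e1 e2 e3 nu[of "I t \<inter> {..s}"] nu[of "{..s}"] by auto
  qed
  have B: "sets (borel :: (real \<times> real) measure) = sigma_sets UNIV (range (\<lambda>a. {..a}))"
    by (subst borel_eq_atMost) simp
  show ?thesis
  proof (rule measure_eqI_generator_eq)
    show "Int_stable (range (\<lambda>a :: real \<times> real. {..a}))"
    proof (rule Int_stableI)
      fix X Y assume "X \<in> range (\<lambda>a :: real \<times> real. {..a})" "Y \<in> range (\<lambda>a :: real \<times> real. {..a})"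
      then obtain a b where "X = {..a}" "Y = {..b}"
        by blast
      then have "X \<inter> Y = {..(min (fst a) (fst b), min (snd a) (snd b))}"
        by (auto simp: less_eq_prod_def)
      then show "X \<inter> Y \<in> range (\<lambda>a. {..a})"
        by blast
    qed
    show "emeasure \<pi> X = emeasure \<rho> X" if "X \<in> range (\<lambda>a. {..a})" for X
      using that eq[OF assms(1) cut(1)] eq[OF assms(2) cut(2)] by force
    show "sets \<pi> = sigma_sets UNIV (range (\<lambda>a. {..a}))" "sets \<rho> = sigma_sets UNIV (range (\<lambda>a. {..a}))"
      using assms(1,2)[THEN unif_martingale_coupling.sets_pi] B by simp_all
    show "range (\<lambda>i. {..(real i, real i)}) \<subseteq> range (\<lambda>a. {..a})"
      by auto
    have "z \<in> (\<Union>i. {..(real i, real i)})" for z :: "real \<times> real"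
      using real_arch_simple[of "max (fst z) (snd z)"] by (auto simp: less_eq_prod_def)
    then show "(\<Union>i. {..(real i, real i)}) = UNIV"
      by blast
    show "emeasure \<pi> {..(real i, real i)} \<noteq> \<infinity>" for i
    proof -
      interpret unif_martingale_coupling \<pi>
        by fact
      show ?thesis by simp
    qed
  qed simp
qed

lemma is_left_curtain_pi_lc: "is_left_curtain mu_unif nu_unif pi_lc"
  unfolding is_left_curtain_def
proof (intro conjI allI impI martingale_coupling_pi_lc left_monotone_pi_lc)
  fix \<pi>' assume *: "martingale_coupling mu_unif nu_unif \<pi>' \<and> left_monotone \<pi>'"
  then interpret unif_martingale_coupling \<pi>'
    by unfold_locales simp
  show "\<pi>' = pi_lc"
    using * by (intro coupling_eqI_cut[where I="\<lambda>t. {D_lc t<..<U_lc t}"] left_monotone_cut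
        lc.left_monotone_cut left_monotone_pi_lc unif_martingale_coupling_axioms
        lc.unif_martingale_coupling_axioms) auto
qed

section \<open>The threshold k = 3\<close>

lemma pi_lc_in_M_set_iff:
  assumes "0 < k"
  shows "pi_lc \<in> M_set k mu_unif nu_unif \<longleftrightarrow> 3 \<le> k"
proof -
  note [measurable] = borel_measurable_fst_snd
  have G_eq: "Gamma_set k = {z. snd z \<ge> fst z - k}"
    by (auto simp: Gamma_set_def)
  have G: "Gamma_set k \<in> sets borel"
    unfolding G_eq by measurable
  have "pi_lc \<in> M_set k mu_unif nu_unif \<longleftrightarrow> emeasure pi_lc (Gamma_set k) = 1"
    by (simp add: M_set_def martingale_coupling_pi_lc)
  also have "\<dots> \<longleftrightarrow> (AE z in pi_lc. z \<in> Gamma_set k)"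
    using lc.AE_prob_1[of "Gamma_set k"] lc.emeasure_eq_1_AE[of "Gamma_set k"] G
    by (auto simp: sets_pi_lc measure_def)
  also have "\<dots> \<longleftrightarrow> (AE x in mu_unif. x - k \<le> D_lc x \<and> x - k \<le> U_lc x)"
    using G by (subst AE_pi_lc) (auto simp: Gamma_set_def)
  also have "\<dots> \<longleftrightarrow> (AE x in lborel. x \<in> {-1..1} \<longrightarrow> x - k \<le> D_lc x \<and> x - k \<le> U_lc x)"
    by (rule AE_uniform_Icc) simp
  also have "\<dots> \<longleftrightarrow> 3 \<le> k"
  proof
    assume "3 \<le> k"
    then show "AE x in lborel. x \<in> {-1..1} \<longrightarrow> x - k \<le> D_lc x \<and> x - k \<le> U_lc x"
      by (auto simp: D_lc_def U_lc_def)
  next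
    assume ae: "AE x in lborel. x \<in> {-1..1} \<longrightarrow> x - k \<le> D_lc x \<and> x - k \<le> U_lc x"
    show "3 \<le> k"
    proof (rule ccontr)
      assume k: "\<not> 3 \<le> k"
      \<comment> \<open>The inequality \<open>x - k \<le> D_lc x\<close> means
        \<open>x \<le> 2 * k / 3 - 1\<close>. Positivity of \<open>k\<close> places this bound above
        -1, so the violating interval lies in the support; for k < 3 it has positive length.\<close>
      have "AE x in lborel. x \<notin> {2 * k / 3 - 1<..1}"
        using ae by eventually_elim (use \<open>0 < k\<close> in \<open>auto simp: D_lc_def field_simps\<close>)
      then have "emeasure lborel {2 * k / 3 - 1<..1} = 0"
        by (subst (asm) AE_iff_measurable[of "{2 * k / 3 - 1<..1}"]) auto
      then show False
        using k by simp
    qed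
  qed
  finally show ?thesis .
qed

subsection \<open>Optimality\<close>

text \<open>Outside \<open>{d..u}\<close> the bound comes from a longer chord: the endpoint nearer
  to \<open>y\<close> lies between \<open>y\<close> and the other endpoint, so convexity applies
  there and is rearranged.\<close>

lemma convex_on_chord:
  fixes f :: "real \<Rightarrow> real"
  assumes f: "convex_on I f" and I: "d \<in> I" "u \<in> I" "y \<in> I" and "d < u"
  defines "c \<equiv> \<lambda>y. f d + (f u - f d) / (u - d) * (y - d)"
  shows "y \<in> {d..u} \<Longrightarrow> f y \<le> c y" "y \<notin> {d..u} \<Longrightarrow> c y \<le> f y"
proof -
  have sub: "convex_on {p..q} f" if "p \<in> I" "q \<in> I" "p \<le> q" for p q
  proof (rule convex_on_subset[OF f])
    show "{p..q} \<subseteq> I"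
      using closed_segment_subset[OF that(1,2) convex_on_imp_convex[OF f]] that(3)
      by (simp add: closed_segment_eq_real_ivl)
  qed simp
  show "f y \<le> c y" if "y \<in> {d..u}"
    using convex_onD_Icc'[OF sub[OF I(1,2) less_imp_le[OF \<open>d < u\<close>]] that] by (simp add: c_def)
  show "c y \<le> f y" if "y \<notin> {d..u}"
  proof (cases "y < d")
    case True
    have "f d \<le> (f y - f u) / (u - y) * (u - d) + f u"
      using convex_onD_Icc''[OF sub[OF I(3,2)], of d] True \<open>d < u\<close> by simp
    then have "(f d - f u) * (u - y) \<le> (f y - f u) * (u - d)"
      using True \<open>d < u\<close> by (simp add: field_simps)
    then show ?thesis
      using \<open>d < u\<close> by (simp add: c_def field_simps)
  next
    case False
    then have "u < y"
      using that by auto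
    have "f u \<le> (f y - f d) / (y - d) * (u - d) + f d"
      using convex_onD_Icc'[OF sub[OF I(1,3)], of u] \<open>u < y\<close> \<open>d < u\<close> by simp
    then have "(f u - f d) * (y - d) \<le> (f y - f d) * (u - d)"
      using \<open>u < y\<close> \<open>d < u\<close> by (simp add: field_simps)
    then show ?thesis
      using \<open>d < u\<close> by (simp add: c_def field_simps)
  qed
qed

text \<open>The integral of \<open>f\<close> over \<open>\<nu>\<close> restricted to \<open>(D t, U t)\<close>, split along the chord \<open>c\<close> of \<open>f\<close>
  so that it is visibly determined by the two marginals.\<close>

definition cut_value :: "(real \<Rightarrow> real) \<Rightarrow> real \<Rightarrow> real" where
  "cut_value f t = (let d = D_lc t; u = U_lc t; c = (\<lambda>y. f d + (f u - f d) / (u - d) * (y - d)) in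
     (\<integral>y. indicator {d<..<u} y * (f y - c y) \<partial>nu_unif) + (\<integral>x. indicator {..t} x * c x \<partial>mu_unif))"

context unif_martingale_coupling
begin

lemma integrable_bounded_pi:
  assumes [measurable]: "F \<in> borel_measurable \<pi>" and "\<And>z. snd z \<in> {-2..2} \<Longrightarrow> \<bar>F z\<bar> \<le> B"
  shows "integrable \<pi> (F :: _ \<Rightarrow> real)"
proof (rule integrable_const_bound)
  show "AE z in \<pi>. norm (F z) \<le> B"
    using AE_snd_Icc by eventually_elim (use assms(2) in auto)
qed simp

text \<open>The affine part \<open>c\<close> contributes the same under every martingale coupling,
  since \<open>snd\<close> may be replaced by \<open>fst\<close>. The range of \<open>t\<close>
  ensures d < u and keeps both in [-2, 2], where \<open>f\<close> is convex.\<close>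

lemma cut_value_le:
  fixes f :: "real \<Rightarrow> real"
  assumes f [measurable]: "f \<in> borel_measurable borel" and bnd: "\<And>y. \<bar>f y\<bar> \<le> B"
    and conv: "convex_on {-2..2} f" and t: "-1 < t" "t \<le> 1"
  shows "cut_value f t \<le> (\<integral>z. indicator {..t} (fst z) * f (snd z) \<partial>\<pi>)"
    and "(AE z in \<pi>. fst z \<le> t \<longleftrightarrow> snd z \<in> {D_lc t<..<U_lc t}) \<Longrightarrow>
      cut_value f t = (\<integral>z. indicator {..t} (fst z) * f (snd z) \<partial>\<pi>)"
proof -
  define d where "d = D_lc t"
  define u where "u = U_lc t"
  define \<beta> where "\<beta> = (f u - f d) / (u - d)"
  define c where "c y = f d + \<beta> * (y - d)" for y
  have du: "d \<in> {-2..2}" "u \<in> {-2..2}" "d < u"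
    using t by (auto simp: d_def u_def D_lc_def U_lc_def)
  have [measurable]: "c \<in> borel_measurable borel"
    unfolding c_def by measurable
  have chord: "y \<in> {-2..2} \<Longrightarrow> y \<in> {d<..<u} \<Longrightarrow> f y \<le> c y"
    "y \<in> {-2..2} \<Longrightarrow> y \<notin> {d<..<u} \<Longrightarrow> c y \<le> f y" for y
  proof -
    assume y: "y \<in> {-2..2}"
    note ch = convex_on_chord[OF conv du(1,2) y du(3), folded \<beta>_def, folded c_def]
    show "f y \<le> c y" if "y \<in> {d<..<u}"
      using ch(1) that by simp
    \<comment> \<open>The chord lemma uses the closed interval; at its two endpoints
      \<open>c\<close> and \<open>f\<close> coincide.\<close>
    show "c y \<le> f y" if "y \<notin> {d<..<u}"
      using ch(2) that du(3) by (cases "y = d \<or> y = u") (auto simp: c_def \<beta>_def)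
  qed
  have c_bound: "\<bar>c y\<bar> \<le> B + \<bar>\<beta>\<bar> * 4" if "y \<in> {-2..2}" for y
  proof -
    have "\<bar>c y\<bar> \<le> \<bar>f d\<bar> + \<bar>\<beta>\<bar> * \<bar>y - d\<bar>"
      unfolding c_def by (rule order_trans[OF abs_triangle_ineq]) (simp add: abs_mult)
    also have "\<dots> \<le> B + \<bar>\<beta>\<bar> * 4"
      using bnd[of d] that du(1) by (intro add_mono mult_left_mono) auto
    finally show ?thesis .
  qed
  have B: "0 \<le> B"
    using bnd[of 0] by linarith
  have fc_bound: "\<bar>f y - c y\<bar> \<le> 2 * B + \<bar>\<beta>\<bar> * 4" if "y \<in> {-2..2}" for y
    using c_bound[OF that] bnd[of y] by linarith
  have i1: "integrable \<pi> (\<lambda>z. indicator {..t} (fst z) * (f (snd z) - c (snd z)))"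
    by (rule integrable_bounded_pi[where B="2 * B + \<bar>\<beta>\<bar> * 4"])
      (use fc_bound B in \<open>auto simp: indicator_def\<close>)
  have i2: "integrable \<pi> (\<lambda>z. indicator {d<..<u} (snd z) * (f (snd z) - c (snd z)))"
    by (rule integrable_bounded_pi[where B="2 * B + \<bar>\<beta>\<bar> * 4"])
      (use fc_bound B in \<open>auto simp: indicator_def\<close>)
  have i3: "integrable \<pi> (\<lambda>z. indicator {..t} (fst z) * c (snd z))"
    by (rule integrable_bounded_pi[where B="B + \<bar>\<beta>\<bar> * 4"])
      (use c_bound B in \<open>auto simp: indicator_def\<close>)
  have j: "integrable \<pi> (\<lambda>z. indicator {..t} (fst z) * fst z)" "integrable \<pi> (\<lambda>z. indicator {..t} (fst z) * snd z)"
      "integrable \<pi> (\<lambda>z. indicator {..t} (fst z) :: real)"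
    by (simp_all add: integrable_indicator_fst integrable_indicator_snd integrable_indicator_pi)
  have c_alt: "e * c y = (f d - \<beta> * d) * e + \<beta> * (e * y)" for e y
    by (simp add: c_def algebra_simps)
  have "(\<integral>z. indicator {..t} (fst z) * c (snd z) \<partial>\<pi>)
      = (f d - \<beta> * d) * (\<integral>z. indicator {..t} (fst z) \<partial>\<pi>) + \<beta> * (\<integral>z. indicator {..t} (fst z) * snd z \<partial>\<pi>)"
    unfolding c_alt using j
    by (subst Bochner_Integration.integral_add) auto
  also have "\<dots> = (f d - \<beta> * d) * (\<integral>z. indicator {..t} (fst z) \<partial>\<pi>) + \<beta> * (\<integral>z. indicator {..t} (fst z) * fst z \<partial>\<pi>)"
    by (subst martingale_indicator) auto
  also have "\<dots> = (\<integral>z. indicator {..t} (fst z) * c (fst z) \<partial>\<pi>)"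
    unfolding c_alt using j
    by (subst Bochner_Integration.integral_add) auto
  also have "\<dots> = (\<integral>x. indicator {..t} x * c x \<partial>mu_unif)"
    by (rule integral_fst_pi) measurable
  finally have chord_part: "(\<integral>z. indicator {..t} (fst z) * c (snd z) \<partial>\<pi>) = (\<integral>x. indicator {..t} x * c x \<partial>mu_unif)" .
  have val: "cut_value f t = (\<integral>z. indicator {d<..<u} (snd z) * (f (snd z) - c (snd z)) \<partial>\<pi>)
      + (\<integral>z. indicator {..t} (fst z) * c (snd z) \<partial>\<pi>)"
    unfolding chord_part cut_value_def Let_def d_def[symmetric] u_def[symmetric] \<beta>_def[symmetric] c_def[symmetric]
    by (subst integral_snd_pi[symmetric]) auto
  have split: "(\<integral>z. indicator {..t} (fst z) * f (snd z) \<partial>\<pi>)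
      = (\<integral>z. indicator {..t} (fst z) * (f (snd z) - c (snd z)) \<partial>\<pi>) + (\<integral>z. indicator {..t} (fst z) * c (snd z) \<partial>\<pi>)"
    using i1 i3 by (subst Bochner_Integration.integral_add[symmetric]) (auto simp: algebra_simps)
  \<comment> \<open>The sides differ only if exactly one event occurs: then either the left is
    nonpositive and the right 0, or the left is 0 and the right nonnegative.\<close>
  have "AE z in \<pi>. indicator {d<..<u} (snd z) * (f (snd z) - c (snd z)) \<le> indicator {..t} (fst z) * (f (snd z) - c (snd z))"
    using AE_snd_Icc
  proof eventually_elim
    case (elim z)
    show ?case
      using chord[OF elim] by (cases "snd z \<in> {d<..<u}"; cases "fst z \<le> t") auto
  qed
  then show "cut_value f t \<le> (\<integral>z. indicator {..t} (fst z) * f (snd z) \<partial>\<pi>)"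
    unfolding val split using i1 i2 by (intro add_right_mono integral_mono_AE) auto
  assume "AE z in \<pi>. fst z \<le> t \<longleftrightarrow> snd z \<in> {D_lc t<..<U_lc t}"
  then have "(\<integral>z. indicator {d<..<u} (snd z) * (f (snd z) - c (snd z)) \<partial>\<pi>)
      = (\<integral>z. indicator {..t} (fst z) * (f (snd z) - c (snd z)) \<partial>\<pi>)"
    unfolding d_def[symmetric] u_def[symmetric]
    by (intro integral_cong_AE) (auto elim!: eventually_mono simp: indicator_def)
  then show "cut_value f t = (\<integral>z. indicator {..t} (fst z) * f (snd z) \<partial>\<pi>)"
    unfolding val split by simp
qed

end

section \<open>The cost as an integral over cut levels\<close>

text \<open>Retraction of the line onto [-3, 3]. Composing with it makes functions that are
  controlled only on [-3, 3] continuous and bounded everywhere.\<close>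

definition clamp3 :: "real \<Rightarrow> real" where
  "clamp3 x = max (-3) (min 3 x)"

lemma clamp3_mem: "clamp3 x \<in> {-3..3}"
  by (auto simp: clamp3_def)

lemma clamp3_eq: "x \<in> {-3..3} \<Longrightarrow> clamp3 x = x"
  by (auto simp: clamp3_def)

lemma continuous_on_clamp3:
  assumes "continuous_on {-3..3} f"
  shows "continuous_on UNIV (\<lambda>x. f (clamp3 x))"
proof -
  have "continuous_on UNIV clamp3"
    unfolding clamp3_def by (intro continuous_intros)
  then show ?thesis
    using clamp3_mem by (intro continuous_on_compose2[OF assms]) auto
qed

lemma bounded_clamp3:
  fixes f :: "real \<Rightarrow> real"
  assumes "continuous_on {-3..3} f"
  obtains B where "\<And>x. \<bar>f (clamp3 x)\<bar> \<le> B"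
proof -
  have "bounded (f ` {-3..3})"
    by (intro compact_imp_bounded compact_continuous_image assms) simp
  then obtain B where "\<And>y. y \<in> f ` {-3..3} \<Longrightarrow> norm y \<le> B"
    unfolding bounded_iff by blast
  then show thesis
    using clamp3_mem by (intro that[of B]) auto
qed

context unif_martingale_coupling
begin

context
  fixes h h' :: "real \<Rightarrow> real"
  assumes h: "\<And>x. x \<in> {-3..3} \<Longrightarrow> (h has_real_derivative h' x) (at x within {-3..3})"
    and h': "continuous_on {-3..3} h'"
begin

text \<open>Justifies the exchange of integrals in \<open>cost_eq\<close>: the integrand is bounded
  and vanishes off a strip of finite measure.\<close>

lemma integrable_cut_product:
  "integrable (\<pi> \<Otimes>\<^sub>M lborel) (\<lambda>(z, t). indicator {-1..1} t * (indicator {..t} (fst z) * h' (clamp3 (snd z - t))))"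
proof -
  interpret P: pair_sigma_finite \<pi> lborel
    by unfold_locales
  obtain B where B: "\<And>x. \<bar>h' (clamp3 x)\<bar> \<le> B"
    using bounded_clamp3[OF h'] by blast
  have B0: "0 \<le> B"
    using B[of 0] by linarith
  have [measurable]: "(\<lambda>x. h' (clamp3 x)) \<in> borel_measurable borel"
    by (intro borel_measurable_continuous_onI continuous_on_clamp3 h')
  \<comment> \<open>The indicated set depends on \<open>t\<close>; as a conditional, the term is
    visibly measurable jointly in \<open>z\<close> and \<open>t\<close>.\<close>
  have ind: "indicator {..t} (fst z) = (if fst z \<le> t then 1 else 0 :: real)" for t and z :: "real \<times> real"
    by (simp add: indicator_def)
  show ?thesis
  proof (rule Bochner_Integration.integrable_bound)
    have "emeasure (\<pi> \<Otimes>\<^sub>M lborel) (UNIV \<times> {-1..1::real}) = emeasure \<pi> UNIV * emeasure lborel {-1..1::real}"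
      by (intro lborel.emeasure_pair_measure_Times) (simp_all add: sets_pi)
    then have "emeasure (\<pi> \<Otimes>\<^sub>M lborel) (UNIV \<times> {-1..1::real}) < \<infinity>"
      using emeasure_space_1 by (simp add: space_pi)
    moreover have "UNIV \<times> {-1..1::real} \<in> sets (\<pi> \<Otimes>\<^sub>M lborel)"
      by (intro pair_measureI) (simp_all add: sets_pi)
    ultimately have "integrable (\<pi> \<Otimes>\<^sub>M lborel) (indicator (UNIV \<times> {-1..1::real}) :: _ \<Rightarrow> real)"
      by (intro integrable_real_indicator)
    then show "integrable (\<pi> \<Otimes>\<^sub>M lborel) (\<lambda>p. B * indicator (UNIV \<times> {-1..1::real}) p)"
      by (intro integrable_mult_right)
    show "(\<lambda>(z, t). indicator {-1..1} t * (indicator {..t} (fst z) * h' (clamp3 (snd z - t))))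
        \<in> borel_measurable (\<pi> \<Otimes>\<^sub>M lborel)"
      unfolding ind by measurable
    show "AE p in \<pi> \<Otimes>\<^sub>M lborel. norm (case p of (z, t) \<Rightarrow> indicator {-1..1} t * (indicator {..t} (fst z) * h' (clamp3 (snd z - t))))
        \<le> norm (B * indicator (UNIV \<times> {-1..1}) p)"
      using B B0 by (intro always_eventually) (auto simp: indicator_def)
  qed
qed

lemma integrable_cut:
  "integrable lborel (\<lambda>t. indicator {-1..1} t * (\<integral>z. indicator {..t} (fst z) * h' (clamp3 (snd z - t)) \<partial>\<pi>))"
proof -
  interpret P: pair_sigma_finite \<pi> lborel
    by unfold_locales
  show ?thesis
    using P.integrable_snd[OF integrable_cut_product] by simp
qed

text \<open>The first term depends on the second marginal alone, so couplings can be compared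
  separately at each level \<open>t\<close>.\<close>

lemma cost_eq:
  "cost h \<pi> = (\<integral>y. h (clamp3 (y - 1)) \<partial>nu_unif)
    + (\<integral>t. indicator {-1..1} t * (\<integral>z. indicator {..t} (fst z) * h' (clamp3 (snd z - t)) \<partial>\<pi>) \<partial>lborel)"
proof -
  interpret P: pair_sigma_finite \<pi> lborel
    by unfold_locales
  have cont_h: "continuous_on {-3..3} h"
    using h by (meson DERIV_continuous_on)
  obtain B where B: "\<And>x. \<bar>h (clamp3 x)\<bar> \<le> B"
    using bounded_clamp3[OF cont_h] by blast
  have [measurable]: "(\<lambda>x. h (clamp3 x)) \<in> borel_measurable borel"
    by (intro borel_measurable_continuous_onI continuous_on_clamp3 cont_h)
  define I where "I z = (\<integral>t. indicator {-1..1} t * (indicator {..t} (fst z) * h' (clamp3 (snd z - t))) \<partial>lborel)"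
    for z :: "real \<times> real"
  have I_int: "integrable \<pi> I"
    using P.integrable_fst[OF integrable_cut_product] by (simp add: I_def[abs_def])
  \<comment> \<open>For these \<open>x\<close>, \<open>y\<close> and x \<le> t \<le> 1, the
    difference y - t stays in [-3, 3], so the clamp is inactive. An antiderivative in
    \<open>t\<close> is -h(y - t).\<close>
  have ftc: "I (x, y) = h (y - x) - h (y - 1)" if x: "x \<in> {-1..1}" and y: "y \<in> {-2..2}" for x y
  proof -
    have "I (x, y) = (\<integral>t. indicator {x..1} t *\<^sub>R h' (y - t) \<partial>lborel)"
      unfolding I_def using x y by (intro Bochner_Integration.integral_cong) (auto simp: indicator_def clamp3_eq)
    also have "\<dots> = - h (y - 1) - - h (y - x)"
    proof (rule integral_FTC_Icc)
      show "continuous_on {x..1} (\<lambda>t. h' (y - t))"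
        using x y by (intro continuous_on_compose2[OF h'] continuous_intros) auto
      fix t assume t: "x \<le> t" "t \<le> 1"
      have "(h \<circ> (\<lambda>t. y - t) has_real_derivative h' (y - t) * (-1)) (at t within {x..1})"
        using x y t
        by (intro DERIV_image_chain has_field_derivative_subset[OF h]) (auto intro!: derivative_eq_intros)
      then show "((\<lambda>t. - h (y - t)) has_vector_derivative h' (y - t)) (at t within {x..1})"
        unfolding has_real_derivative_iff_has_vector_derivative[symmetric] using DERIV_minus by (fastforce simp: o_def)
    qed (use x in auto)
    finally show ?thesis
      by simp
  qed
  have S_eq: "{(x, y). y - x \<in> {-3..3}} = {z :: real \<times> real. snd z - fst z \<in> {-3..3}}"
    by auto
  have "cost h \<pi> = (\<integral>z. indicator {z. snd z - fst z \<in> {-3..3}} z * h (clamp3 (snd z - fst z)) \<partial>\<pi>)"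
    unfolding cost_def S_eq set_lebesgue_integral_def
    by (intro Bochner_Integration.integral_cong) (auto simp: indicator_def clamp3_eq)
  also have "\<dots> = (\<integral>z. h (clamp3 (snd z - 1)) + I z \<partial>\<pi>)"
  proof (rule integral_cong_AE)
    show "(\<lambda>z. h (clamp3 (snd z - 1)) + I z) \<in> borel_measurable \<pi>"
      using I_int by measurable
    have [measurable]: "{z. snd z - fst z \<in> {-3..3}} \<in> sets \<pi>"
      using measurable_sets[of "\<lambda>z. snd z - fst z" \<pi> borel "{-3..3}"] by (simp add: space_pi vimage_def)
    show "(\<lambda>z. indicator {z. snd z - fst z \<in> {-3..3}} z * h (clamp3 (snd z - fst z))) \<in> borel_measurable \<pi>"
      by measurable
    show "AE z in \<pi>. indicator {z. snd z - fst z \<in> {-3..3}} z * h (clamp3 (snd z - fst z)) = h (clamp3 (snd z - 1)) + I z"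
      using AE_fst_Icc AE_snd_Icc
    proof eventually_elim
      case (elim z)
      then show ?case
        using ftc[of "fst z" "snd z"] by (simp add: clamp3_eq)
    qed
  qed
  also have "\<dots> = (\<integral>z. h (clamp3 (snd z - 1)) \<partial>\<pi>) + (\<integral>z. I z \<partial>\<pi>)"
    by (intro Bochner_Integration.integral_add I_int integrable_bounded_pi[where B=B]) (auto simp: B)
  also have "(\<integral>z. h (clamp3 (snd z - 1)) \<partial>\<pi>) = (\<integral>y. h (clamp3 (y - 1)) \<partial>nu_unif)"
    by (rule integral_snd_pi) measurable
  also have "(\<integral>z. I z \<partial>\<pi>) = (\<integral>t. (\<integral>z. indicator {-1..1} t * (indicator {..t} (fst z) * h' (clamp3 (snd z - t))) \<partial>\<pi>) \<partial>lborel)"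
    unfolding I_def by (rule P.Fubini_integral[OF integrable_cut_product, symmetric])
  finally show ?thesis
    by simp
qed

end

end

text \<open>At each level \<open>pi_lc\<close> attains \<open>cut_value\<close>, which bounds every
  competitor from below; integrating over levels compares the costs.\<close>

lemma (in unif_martingale_coupling) cost_pi_lc_le:
  assumes h: "\<And>x. x \<in> {-3..3} \<Longrightarrow> (h has_real_derivative h' x) (at x within {-3..3})"
    and h': "continuous_on {-3..3} h'" and conv: "convex_on {-3..3} h'"
  shows "cost h pi_lc \<le> cost h \<pi>"
proof -
  obtain B where B: "\<And>x. \<bar>h' (clamp3 x)\<bar> \<le> B"
    using bounded_clamp3[OF h'] by blast
  have m: "(\<lambda>x. h' (clamp3 x)) \<in> borel_measurable borel"
    by (intro borel_measurable_continuous_onI continuous_on_clamp3 h')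
  have "(\<integral>z. indicator {..t} (fst z) * h' (clamp3 (snd z - t)) \<partial>pi_lc)
      \<le> (\<integral>z. indicator {..t} (fst z) * h' (clamp3 (snd z - t)) \<partial>\<pi>)" if t: "-1 < t" "t \<le> 1" for t
  proof -
    have f: "(\<lambda>y. h' (clamp3 (y - t))) \<in> borel_measurable borel"
      using m by measurable
    have c: "convex_on {-2..2} (\<lambda>y. h' (clamp3 (y - t)))"
    proof (rule convex_onI)
      fix s x y :: real
      assume *: "0 < s" "s < 1" "x \<in> {-2..2}" "y \<in> {-2..2}"
      have "(1 - s) *\<^sub>R x + s *\<^sub>R y \<in> {-2..2}"
        using * convexD[of "{-2..2::real}" x y "1 - s" s] by (simp add: convex_real_interval)
      then have "clamp3 ((1 - s) *\<^sub>R x + s *\<^sub>R y - t) = (1 - s) *\<^sub>R (x - t) + s *\<^sub>R (y - t)"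
        using t by (subst clamp3_eq) (auto simp: algebra_simps)
      then show "h' (clamp3 ((1 - s) *\<^sub>R x + s *\<^sub>R y - t)) \<le> (1 - s) * h' (clamp3 (x - t)) + s * h' (clamp3 (y - t))"
        using convex_onD[OF conv, of s "x - t" "y - t"] * t by (simp add: clamp3_eq)
    qed simp
    show ?thesis
      using cut_value_le(1)[OF f B c t] lc.cut_value_le(2)[OF f B c t lc.left_monotone_cut[OF left_monotone_pi_lc t]]
      by simp
  qed
  \<comment> \<open>The level t = -1, not covered by the cut lemmas, is a null set.\<close>
  then have "AE t in lborel. indicator {-1..1} t * (\<integral>z. indicator {..t} (fst z) * h' (clamp3 (snd z - t)) \<partial>pi_lc)
      \<le> indicator {-1..1} t * (\<integral>z. indicator {..t} (fst z) * h' (clamp3 (snd z - t)) \<partial>\<pi>)"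
    using AE_lborel_singleton[of "-1"] by (auto elim!: eventually_mono simp: indicator_def)
  then show ?thesis
    using integral_mono_AE[OF lc.integrable_cut[OF h h'] integrable_cut[OF h h']] cost_eq[of h h', OF h h'] lc.cost_eq[of h h', OF h h']
    by simp
qed

text \<open>Derivatives taken within [-3, 3] are one-sided at the endpoints. Membership and
  \<open>bdd_below\<close> are asserted because a real \<open>INF\<close> is meaningful only over a
  nonempty set bounded below.\<close>

theorem proposition2p3:
  shows "is_left_curtain mu_unif nu_unif pi_lc
    \<and> (\<forall>k>0. pi_lc \<in> M_set k mu_unif nu_unif \<longleftrightarrow> k \<ge> 3)
    \<and> (\<forall>k\<ge>3. \<forall>h h'.
          (\<forall>x\<in>{-3..3}. (h has_real_derivative h' x) (at x within {-3..3})) \<and>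
          continuous_on {-3..3} h' \<and> convex_on {-3..3} h' \<longrightarrow>
          pi_lc \<in> M_set k mu_unif nu_unif \<and>
          bdd_below (cost h ` M_set k mu_unif nu_unif) \<and>
          cost h pi_lc = (INF \<pi>\<in>M_set k mu_unif nu_unif. cost h \<pi>))"
proof (intro conjI allI impI is_left_curtain_pi_lc)
  show "pi_lc \<in> M_set k mu_unif nu_unif \<longleftrightarrow> k \<ge> 3" if "0 < k" for k
    using that by (rule pi_lc_in_M_set_iff)
next
  fix k :: real and h h' :: "real \<Rightarrow> real"
  assume k: "3 \<le> k" and H: "(\<forall>x\<in>{-3..3}. (h has_real_derivative h' x) (at x within {-3..3})) \<and>
          continuous_on {-3..3} h' \<and> convex_on {-3..3} h'"
  show mem: "pi_lc \<in> M_set k mu_unif nu_unif"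
    using k pi_lc_in_M_set_iff[of k] by simp
  have le: "cost h pi_lc \<le> cost h \<pi>" if "\<pi> \<in> M_set k mu_unif nu_unif" for \<pi>
  proof -
    interpret unif_martingale_coupling \<pi>
      using that by unfold_locales (simp add: M_set_def)
    show ?thesis
      using H by (intro cost_pi_lc_le) auto
  qed
  then show "bdd_below (cost h ` M_set k mu_unif nu_unif)"
    by (rule bdd_belowI2)
  show "cost h pi_lc = (INF \<pi>\<in>M_set k mu_unif nu_unif. cost h \<pi>)"
    using mem le by (intro cInf_eq_minimum[symmetric]) auto
qed

end
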